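(* Let $d\ge1$. A function $f:[0,1]^d\to\mathbb{R}$ has bounded Hardy--Krause variation if and only if it has bounded $\mathcal{R}^*$-variation, that is, $\mathcal{HK}=\mathcal{V}(\mathcal{R}^* )$; moreover, for every function $f:[0,1]^d\to\mathbb{R}$, $$HK(f;[0,1]^d)=V_{\mathcal{R}^*}(f)$$ (as elements of $[0,\infty]$).
   Context: Hardy--Krause variation. For points $\mathbf{a},\mathbf{b}\in[0,1]^d$ and $u\subseteq\{1,\dots,d\}$, let $\mathbf{a}^u:\mathbf{b}^{-u}$ denote the point whose $i$-th coordinate is $a_i$ if $i\in u$ and $b_i$ if $i\notin u$. For $\mathbf{a}\le\mathbf{b}$ (coordinatewise) put $$\Delta_u(f;[\mathbf{a},\mathbf{b}])=\sum_{v\subseteq u}(-1)^{|v|}f(\mathbf{a}^v:\mathbf{b}^{-v}).$$ A one-dimensional ladder is a finite set $\{0=y_1<y_2<\dots<y_k<1\}$ (with $k\ge1$); the successor of $y_i$ is $(y_i)_+=y_{i+1}$ if $i<k$, and $(y_k)_+=1$. A ladder in $[0,1]^d$ is a product $\mathcal{Y}=\prod_{j=1}^d\mathcal{Y}^j$ of one-dimensional ladders; let $\mathbb{Y}$ be the set of all ladders in $[0,1]^d$. Let $\mathbf{1}=(1,\dots,1)$. For $\emptyset\ne u\subseteq\{1,\dots,d\}$ let $\mathcal{Y}_u=\{\mathbf{y}^u:\mathbf{1}^{-u}\mid\mathbf{y}\in\mathcal{Y}\}$. For $\mathbf{y}\in\mathcal{Y}_u$ the successor $\mathbf{y}_+$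 is obtained by replacing each coordinate $y_i$ with $i\in u$ by its successor in $\mathcal{Y}^i$, and leaving the coordinates with $i\notin u$ equal to $1$. Put $$V_{\mathcal{Y}_u}(f;[0,1]^d)=\sum_{\mathbf{y}\in\mathcal{Y}_u}|\Delta_u(f;[\mathbf{y},\mathbf{y}_+])|,\qquad HK(f;[0,1]^d)=\sum_{\emptyset\neq u\subseteq\{1,\dots,d\}}\ \sup_{\mathcal{Y}\in\mathbb{Y}}V_{\mathcal{Y}_u}(f;[0,1]^d),$$ and $\mathcal{HK}=\{f:[0,1]^d\to\mathbb{R}\mid HK(f;[0,1]^d)<\infty\}$. The class $\mathcal{R}^*$. For $\mathbf{a}\in[0,1]^d$ and $v\subseteq\{1,\dots,d\}$ let $$[\mathbf{0},\mathbf{a}]^v=\{\mathbf{x}\in\mathbb{R}^d\mid 0\le x_i\le a_i\ \text{for } i\in v,\ \ 0\le x_i<a_i\ \text{for } i\notin v\}$$ (which is empty if $a_i=0$ for some $i\notin v$), and let $\mathcal{R}^*=\{[\mathbf{0},\mathbf{a}]^v\mid\mathbf{a}\in[0,1]^d,\ v\subseteq\{1,\dots,d\}\}$. $\mathcal{D}$-variation. Let $\mathcal{D}$ be a family of (Borel) measurable subsets of $[0,1]^d$ with $\emptyset,[0,1]^d\in\mathcal{D}$ (here $\mathcal{D}=\mathcal{R}^*$). $\mathcal{S}(\mathcal{D})$ is the real vector space of functions $\sum_{i=1}^m\alpha_i\mathds{1}_{A_i}$ with $m\in\mathbb{N}$, $\alpha_i\in\mathbb{R}$, $A_i\in\mathcal{D}$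 ($\mathds{1}_A$ is the indicator function of $A$). A set $A\subseteq[0,1]^d$ is an algebraic sum of sets in $\mathcal{D}$ if $\mathds{1}_A=\sum_{i=1}^n\mathds{1}_{A_i}-\sum_{i=n+1}^m\mathds{1}_{A_i}$ for some $A_1,\dots,A_m\in\mathcal{D}$. For such $A$ with $A\ne\emptyset$, $A\neq[0,1]^d$, the Harman complexity $h_{\mathcal{D}}(A)$ is the minimal $m$ such that $\mathds{1}_A=\sum_{i=1}^n\mathds{1}_{A_i}-\sum_{i=n+1}^m\mathds{1}_{A_i}$ for some $n\in\{0,\dots,m\}$ and sets $A_i$ with, for each $i$, $A_i\in\mathcal{D}$ or $[0,1]^d\setminus A_i\in\mathcal{D}$; also $h_{\mathcal{D}}(\emptyset)=h_{\mathcal{D}}([0,1]^d)=0$. For $f\in\mathcal{S}(\mathcal{D})$ put $$V_{\mathcal{S},\mathcal{D}}(f)=\inf\Big\{\sum_{i=1}^m|\alpha_i|h_{\mathcal{D}}(A_i)\ \Big|\ f=\sum_{i=1}^m\alpha_i\mathds{1}_{A_i},\ \alpha_i\in\mathbb{R},\ A_i\in\mathcal{D}\Big\}.$$ Let $\mathcal{V}_\infty(\mathcal{D})$ be the set of measurable $f:[0,1]^d\to\mathbb{R}$ that are limits in the supremum norm $|\cdot|_\infty$ of sequences in $\mathcal{S}(\mathcal{D})$. For $f\in\mathcal{V}_\infty(\mathcal{D})$, $$V_{\mathcal{D}}(f)=\inf\big\{\liminf_i V_{\mathcal{S},\mathcal{D}}(f_i)\ \big|\ f_i\in\mathcal{S}(\mathcal{D}),\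 \lim_i|f-f_i|_\infty=0\big\},$$ and $V_{\mathcal{D}}(f)=\infty$ if $f\notin\mathcal{V}_\infty(\mathcal{D})$. Finally $\mathcal{V}(\mathcal{D})=\{f\in\mathcal{V}_\infty(\mathcal{D})\mid V_{\mathcal{D}}(f)<\infty\}$ is the space of functions of bounded $\mathcal{D}$-variation. *)

theory Defs
  imports "HOL-Analysis.Analysis"
begin

text \<open>
  The dimension is the cardinality of the finite index type \<open>'n\<close>, and \<open>[0,1]^d\<close> is \<open>cbox 0 1\<close>.
  A function on \<open>[0,1]^d\<close> is rendered as a total function on \<open>real^'n\<close>; all notions below depend
  only on its values on \<open>cbox 0 1\<close>.
\<close>

section \<open>Hardy--Krause variation\<close>

text \<open>\<open>glue a u b\<close> is the point \<open>a^u : b^{-u}\<close>.\<close>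

definition glue :: "real^'n \<Rightarrow> 'n set \<Rightarrow> real^'n \<Rightarrow> real^'n" where
  "glue a u b = (\<chi> i. if i \<in> u then a $ i else b $ i)"

definition Delta :: "'n set \<Rightarrow> (real^'n \<Rightarrow> real) \<Rightarrow> real^'n \<Rightarrow> real^'n \<Rightarrow> real" where
  "Delta u f a b = (\<Sum>v\<in>Pow u. (-1) ^ card v * f (glue a v b))"

definition ladder1 :: "real set \<Rightarrow> bool" where
  "ladder1 Y \<longleftrightarrow> finite Y \<and> 0 \<in> Y \<and> Y \<subseteq> {0..<1}"

definition succ1 :: "real set \<Rightarrow> real \<Rightarrow> real" where
  "succ1 Y y = Min (insert 1 {z \<in> Y. y < z})"

text \<open>A ladder in \<open>[0,1]^d\<close> is given by the family of its factors, which the product determines.\<close>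

definition ladders :: "('n \<Rightarrow> real set) set" where
  "ladders = {Y. \<forall>j. ladder1 (Y j)}"

definition ladder_face :: "('n \<Rightarrow> real set) \<Rightarrow> 'n set \<Rightarrow> (real^'n) set" where
  "ladder_face Y u = {glue y u 1 | y. \<forall>j. y $ j \<in> Y j}"

definition ladder_succ :: "('n \<Rightarrow> real set) \<Rightarrow> 'n set \<Rightarrow> real^'n \<Rightarrow> real^'n" where
  "ladder_succ Y u y = (\<chi> i. if i \<in> u then succ1 (Y i) (y $ i) else y $ i)"

definition ladder_variation :: "('n \<Rightarrow> real set) \<Rightarrow> 'n set \<Rightarrow> (real^'n \<Rightarrow> real) \<Rightarrow> real" where
  "ladder_variation Y u f = (\<Sum>y\<in>ladder_face Y u. \<bar>Delta u f y (ladder_succ Y u y)\<bar>)"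

definition HK :: "(real^'n \<Rightarrow> real) \<Rightarrow> ennreal" where
  "HK f = (\<Sum>u\<in>{u. u \<noteq> {}}. SUP Y\<in>ladders. ennreal (ladder_variation Y u f))"

definition HK_space :: "(real^'n \<Rightarrow> real) set" where
  "HK_space = {f. HK f < \<infinity>}"

section \<open>The class of anchored boxes\<close>

definition anchored_box :: "real^'n \<Rightarrow> 'n set \<Rightarrow> (real^'n) set" where
  "anchored_box a v = {x. \<forall>i. 0 \<le> x $ i \<and> (if i \<in> v then x $ i \<le> a $ i else x $ i < a $ i)}"

definition Rstar :: "(real^'n) set set" where
  "Rstar = {anchored_box a v | a v. a \<in> cbox 0 1}"

section \<open>Variation with respect to a family of sets\<close>

definition algebraic_sum :: "(real^'n) set set \<Rightarrow> (real^'n) set \<Rightarrow> bool" where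
  "algebraic_sum D A \<longleftrightarrow> A \<subseteq> cbox 0 1 \<and>
     (\<exists>(m::nat) n B. n \<le> m \<and> (\<forall>i\<in>{1..m}. B i \<in> D) \<and>
       (\<forall>x\<in>cbox 0 1. indicat_real A x =
          (\<Sum>i=1..n. indicat_real (B i) x) - (\<Sum>i=n+1..m. indicat_real (B i) x)))"

definition harman_rep :: "(real^'n) set set \<Rightarrow> (real^'n) set \<Rightarrow> nat \<Rightarrow> bool" where
  "harman_rep D A m \<longleftrightarrow>
     (\<exists>n B. n \<le> m \<and> (\<forall>i\<in>{1..m}. B i \<subseteq> cbox 0 1 \<and> (B i \<in> D \<or> cbox 0 1 - B i \<in> D)) \<and>
       (\<forall>x\<in>cbox 0 1. indicat_real A x =
          (\<Sum>i=1..n. indicat_real (B i) x) - (\<Sum>i=n+1..m. indicat_real (B i) x)))"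

text \<open>
  Meaningful for algebraic sums \<open>A\<close> of members of \<open>D\<close>, for which a representation exists
  (\<open>harman_rep_exists\<close> below); in particular for \<open>A \<in> D\<close>.
\<close>

definition harman :: "(real^'n) set set \<Rightarrow> (real^'n) set \<Rightarrow> nat" where
  "harman D A = (if A = {} \<or> A = cbox 0 1 then 0 else (LEAST m. harman_rep D A m))"

definition simple_rep ::
    "(real^'n) set set \<Rightarrow> (real^'n \<Rightarrow> real) \<Rightarrow> nat \<Rightarrow> (nat \<Rightarrow> real) \<Rightarrow> (nat \<Rightarrow> (real^'n) set) \<Rightarrow> bool" where
  "simple_rep D f m \<alpha> A \<longleftrightarrow> (\<forall>i\<in>{1..m}. A i \<in> D) \<and>
     (\<forall>x\<in>cbox 0 1. f x = (\<Sum>i=1..m. \<alpha> i * indicat_real (A i) x))"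

definition simple_space :: "(real^'n) set set \<Rightarrow> (real^'n \<Rightarrow> real) set" where
  "simple_space D = {f. \<exists>m \<alpha> A. simple_rep D f m \<alpha> A}"

definition V_simple :: "(real^'n) set set \<Rightarrow> (real^'n \<Rightarrow> real) \<Rightarrow> ennreal" where
  "V_simple D f =
     Inf {ennreal (\<Sum>i=1..m. \<bar>\<alpha> i\<bar> * real (harman D (A i))) | m \<alpha> A. simple_rep D f m \<alpha> A}"

text \<open>Convergence in the supremum norm on \<open>[0,1]^d\<close> is \<open>uniform_limit (cbox 0 1)\<close>.\<close>

definition approx_seqs :: "(real^'n) set set \<Rightarrow> (real^'n \<Rightarrow> real) \<Rightarrow> (nat \<Rightarrow> real^'n \<Rightarrow> real) set" where
  "approx_seqs D f = {g. (\<forall>i. g i \<in> simple_space D) \<and> uniform_limit (cbox 0 1) g f sequentially}"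

definition V_infty :: "(real^'n) set set \<Rightarrow> (real^'n \<Rightarrow> real) set" where
  "V_infty D = {f. f \<in> borel_measurable (restrict_space borel (cbox 0 1)) \<and> approx_seqs D f \<noteq> {}}"

definition V_var :: "(real^'n) set set \<Rightarrow> (real^'n \<Rightarrow> real) \<Rightarrow> ennreal" where
  "V_var D f =
     (if f \<in> V_infty D then INF g\<in>approx_seqs D f. liminf (\<lambda>i. V_simple D (g i)) else \<infinity>)"

definition V_space :: "(real^'n) set set \<Rightarrow> (real^'n \<Rightarrow> real) set" where
  "V_space D = {f \<in> V_infty D. V_var D f < \<infinity>}"

section \<open>Well-definedness\<close>

lemma harman_rep_exists:
  assumes "D \<subseteq> Pow (cbox 0 1)" and "algebraic_sum D A"
  shows "\<exists>m. harman_rep D A m"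
  using assms unfolding harman_rep_def algebraic_sum_def by blast

lemma algebraic_sum_member:
  assumes "D \<subseteq> Pow (cbox 0 1)" and "A \<in> D"
  shows "algebraic_sum D A"
  unfolding algebraic_sum_def
  using assms by (intro conjI exI[of _ 1] exI[of _ "\<lambda>_. A"]) auto

lemma Rstar_subset: "Rstar \<subseteq> Pow (cbox 0 (1 :: real^'n))"
proof
  fix B :: "(real^'n) set" assume "B \<in> Rstar"
  then obtain a v where B: "B = anchored_box a v" and a: "a \<in> cbox 0 1"
    by (auto simp: Rstar_def)
  have "x \<in> cbox 0 1" if "x \<in> B" for x
  proof -
    have "0 \<le> x $ i \<and> x $ i \<le> a $ i \<and> a $ i \<le> 1" for i
      using that a by (auto simp: B anchored_box_def mem_box_cart split: if_splits dest: spec[of _ i])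
    then show ?thesis by (auto simp: mem_box_cart intro: order_trans)
  qed
  then show "B \<in> Pow (cbox 0 1)" by blast
qed

lemma empty_in_Rstar: "{} \<in> Rstar"
proof -
  have "anchored_box 0 {} = ({} :: (real^'n) set)"
    by (auto simp: anchored_box_def)
  then show ?thesis unfolding Rstar_def by (force simp: mem_box_cart)
qed

lemma cube_in_Rstar: "cbox 0 1 \<in> Rstar"
proof -
  have "anchored_box 1 UNIV = (cbox 0 1 :: (real^'n) set)"
    by (auto simp: anchored_box_def mem_box_cart)
  then show ?thesis unfolding Rstar_def by (force simp: mem_box_cart)
qed

lemma Rstar_borel: "Rstar \<subseteq> sets (borel :: (real^'n) measure)"
proof
  fix B :: "(real^'n) set" assume "B \<in> Rstar"
  then obtain a v where B: "B = anchored_box a v"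
    by (auto simp: Rstar_def)
  have "B = (\<Inter>i. {x. 0 \<le> x $ i} \<inter> (if i \<in> v then {x. x $ i \<le> a $ i} else {x. x $ i < a $ i}))"
    by (auto simp: B anchored_box_def split: if_splits)
  also have "\<dots> \<in> sets borel"
    by (intro sets.finite_INT sets.Int)
       (auto intro!: borel_closed borel_open closed_halfspace_component_le_cart
          closed_halfspace_component_ge_cart open_halfspace_component_lt_cart)
  finally show "B \<in> sets borel" .
qed

end

theory Submission
  imports Defs
begin

text \<open>
  Both inequalities rest on one identity, \<open>grid_telescope\<close>: on the grid spanned by a ladder
  \<open>Y\<close>, write evaluation at \<open>p\<^sub>i\<close> as evaluation at \<open>1\<close> minus the increment over \<open>[p\<^sub>i, 1]\<close>, expand
  the product over the coordinates, and split every increment into steps of the ladder. This gives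
  \[ f(p) = \sum_{u} (-1)^{|u|} \sum_{y \in Y_u,\ p_i \le y_i\ (i \in u)} \Delta_u(f;[y,y_+]). \]

  Upper bound for \<open>HK\<close>. For the indicator function of an anchored box the ladder variation over each
  face is the same for all ladders, and these numbers add up to \<open>1\<close> unless the box is empty or the
  whole cube, when they add up to \<open>0\<close>; this is the Harman complexity of the box
  (\<open>Rstar_box_variation\<close>, \<open>Rstar_endpoints_le_harman\<close>). As \<open>HK\<close> is a seminorm, it is bounded by
  \<open>V_simple\<close> on simple functions, and it is lower semicontinuous under pointwise limits
  (\<open>HK_le_liminf\<close>), hence bounded by \<open>V_var\<close>.

  Upper bound for \<open>V_var\<close>. Let \<open>HK f\<close> be finite. By the identity, moving the \<open>j\<close>-th coordinate from
  \<open>s\<close> to \<open>t\<close> changes \<open>f\<close> by at most the variation carried by the slab \<open>s \<le> y\<^sub>j < t\<close>. Disjoint slabs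
  share the total variation, so for given \<open>e > 0\<close> only a bounded number of successive changes can
  exceed \<open>e\<close>. Counting them cuts \<open>[0,1]\<close> into finitely many intervals on which \<open>f\<close> changes by at most
  \<open>e\<close> in direction \<open>j\<close>, uniformly in the other coordinates. Replacing each coordinate by a representative
  \<open>\<rho>\<^sub>j(x\<^sub>j)\<close> of its interval yields a function \<open>g = f \<circ> \<rho>\<close> that is uniformly close to \<open>f\<close>
  (\<open>coordinate_quantizer\<close>). The identity, read at \<open>\<rho>(x)\<close>, writes \<open>g\<close> as a combination of the indicators of
  \<open>{x. \<rho>\<^sub>i(x\<^sub>i) \<le> y\<^sub>i for i \<in> u}\<close>; these sets belong to \<open>Rstar\<close> because the \<open>\<rho>\<^sub>i\<close> are
  monotone, and the coefficients are exactly the terms of a ladder variation of \<open>f\<close>. Therefore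
  \<open>V_simple Rstar g \<le> HK f\<close> (\<open>quantized_function_simple\<close>).
\<close>

section \<open>One-dimensional ladders\<close>

lemma ladder1_finite: "ladder1 Y \<Longrightarrow> finite Y"
  by (simp add: ladder1_def)

lemma
  assumes "ladder1 Y" "y \<in> Y"
  shows succ1_mem: "succ1 Y y \<in> insert 1 Y"
    and succ1_gt: "y < succ1 Y y"
    and succ1_le: "\<And>z. z \<in> insert 1 Y \<Longrightarrow> y < z \<Longrightarrow> succ1 Y y \<le> z"
proof -
  let ?S = "insert 1 {z \<in> Y. y < z}"
  have fin: "finite ?S" and y: "y < 1"
    using assms by (auto simp: ladder1_def)
  have "succ1 Y y \<in> ?S"
    unfolding succ1_def using fin by (intro Min_in) auto
  then show "succ1 Y y \<in> insert 1 Y" "y < succ1 Y y"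
    using y by auto
  show "succ1 Y y \<le> z" if "z \<in> insert 1 Y" "y < z" for z
    unfolding succ1_def using fin that by (intro Min_le) auto
qed

text \<open>
  The recursion peels off the smallest ladder point \<open>p\<close>; what is left are the ladder points from the
  successor of \<open>p\<close> on.
\<close>

lemma ladder1_telescope:
  fixes g :: "real \<Rightarrow> real"
  assumes Y: "ladder1 Y" and p: "p \<in> insert 1 Y"
  shows "(\<Sum>t\<in>{t \<in> Y. p \<le> t}. g (succ1 Y t) - g t) = g 1 - g p"
  using p
proof (induction "card {t \<in> Y. p \<le> t}" arbitrary: p rule: less_induct)
  case less
  have fin: "finite Y" and lt1: "\<And>t. t \<in> Y \<Longrightarrow> t < 1"
    using Y by (auto simp: ladder1_def)
  show ?case
  proof (cases "p = 1")
    case True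
    then have "{t \<in> Y. p \<le> t} = {}" using lt1 by force
    then show ?thesis unfolding \<open>{t \<in> Y. p \<le> t} = {}\<close> using True by simp
  next
    case False
    then have pY: "p \<in> Y" using less.prems by simp
    let ?q = "succ1 Y p"
    have q: "?q \<in> insert 1 Y" "p < ?q"
      using succ1_mem[OF Y pY] succ1_gt[OF Y pY] by auto
    have split: "{t \<in> Y. p \<le> t} = insert p {t \<in> Y. ?q \<le> t}"
      using pY q succ1_le[OF Y pY] by force
    have notin: "p \<notin> {t \<in> Y. ?q \<le> t}" using q by auto
    have "card {t \<in> Y. ?q \<le> t} < card {t \<in> Y. p \<le> t}"
      unfolding split using notin fin by simp
    from less.hyps[OF this q(1)]
    show ?thesis unfolding split using notin fin by simp
  qed
qed

section \<open>The telescoping identity on a grid\<close>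

definition grid :: "('n \<Rightarrow> real set) \<Rightarrow> (real^'n) set" where
  "grid Y = {x. \<forall>i. x $ i \<in> insert 1 (Y i)}"

lemma glue_nth [simp]: "glue a u b $ i = (if i \<in> u then a $ i else b $ i)"
  by (simp add: glue_def)

lemma ladder_succ_nth [simp]:
  "ladder_succ Y u y $ i = (if i \<in> u then succ1 (Y i) (y $ i) else y $ i)"
  by (simp add: ladder_succ_def)

lemma ladders_ladder1: "Y \<in> ladders \<Longrightarrow> ladder1 (Y i)"
  by (simp add: ladders_def)

lemma ladder_face_nth:
  "y \<in> ladder_face Y u \<Longrightarrow> i \<in> u \<Longrightarrow> y $ i \<in> Y i"
  "y \<in> ladder_face Y u \<Longrightarrow> i \<notin> u \<Longrightarrow> y $ i = 1"
  by (auto simp: ladder_face_def)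

lemma grid_glue: "a \<in> grid Y \<Longrightarrow> b \<in> grid Y \<Longrightarrow> glue a v b \<in> grid Y"
  by (simp add: grid_def)

lemma ladder_face_grid: "y \<in> ladder_face Y u \<Longrightarrow> y \<in> grid Y"
  by (auto simp: ladder_face_def grid_def)

lemma ladder_succ_grid:
  assumes "Y \<in> ladders" "y \<in> ladder_face Y u"
  shows "ladder_succ Y u y \<in> grid Y"
  using assms succ1_mem[OF ladders_ladder1[OF assms(1)]]
  by (auto simp: grid_def ladder_face_nth)

lemma grid_cbox:
  assumes "Y \<in> ladders" "x \<in> grid Y"
  shows "x \<in> cbox 0 1"
proof -
  have "0 \<le> x $ i \<and> x $ i \<le> 1" for i
  proof -
    have "x $ i = 1 \<or> x $ i \<in> Y i" "Y i \<subseteq> {0..<1}"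
      using assms(2) ladders_ladder1[OF assms(1), of i] by (auto simp: grid_def ladder1_def)
    then show ?thesis by (auto dest!: subsetD)
  qed
  then show ?thesis by (simp add: mem_box_cart)
qed

text \<open>
  Points of a face have the constant coordinate \<open>1\<close> off \<open>u\<close>, so sums over a face are sums over
  \<open>PiE u Y\<close>, where sums of products factorise.
\<close>

lemma bij_betw_ladder_face:
  "bij_betw (\<lambda>g. \<chi> i. if i \<in> u then g i else 1) (PiE u Y) (ladder_face Y u)"
  if "Y \<in> ladders" for u :: "'n::finite set"
proof (rule bij_betw_byWitness[where f' = "\<lambda>y. restrict (\<lambda>i. y $ i) u"])
  show "(\<lambda>g. \<chi> i. if i \<in> u then g i else 1) ` PiE u Y \<subseteq> ladder_face Y u"
  proof
    fix y :: "real^'n" assume "y \<in> (\<lambda>g. \<chi> i. if i \<in> u then g i else 1) ` PiE u Y"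
    then obtain g where g: "g \<in> PiE u Y" "y = (\<chi> i. if i \<in> u then g i else 1)" by blast
    \<comment> \<open>the coordinates outside \<open>u\<close> are filled with the ladder point \<open>0\<close> before gluing\<close>
    have "y = glue (\<chi> i. if i \<in> u then g i else 0) u 1"
      by (simp add: vec_eq_iff g)
    moreover have "\<forall>j. (\<chi> i. if i \<in> u then g i else 0 :: real^'n) $ j \<in> Y j"
      using g ladders_ladder1[OF that] by (auto simp: ladder1_def)
    ultimately show "y \<in> ladder_face Y u" unfolding ladder_face_def by blast
  qed
next
  show "\<forall>g\<in>PiE u Y. restrict (\<lambda>i. (\<chi> i. if i \<in> u then g i else 1 :: real^'n) $ i) u = g"
  proof (intro ballI ext)
    fix g i assume "g \<in> PiE u Y"
    then show "restrict (\<lambda>i. (\<chi> i. if i \<in> u then g i else 1 :: real^'n) $ i) u i = g i"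
      using PiE_arb[of g u Y i] by (cases "i \<in> u") simp_all
  qed
  show "\<forall>y\<in>ladder_face Y u. (\<chi> i. if i \<in> u then restrict (\<lambda>i. y $ i) u i else 1) = y"
    by (auto simp: vec_eq_iff ladder_face_nth)
  show "(\<lambda>y. restrict (\<lambda>i. y $ i) u) ` ladder_face Y u \<subseteq> PiE u Y"
    by (auto simp: ladder_face_nth)
qed

lemma finite_ladder_face:
  assumes "Y \<in> ladders"
  shows "finite (ladder_face Y (u :: 'n::finite set))"
proof -
  have "finite (PiE u Y)"
    by (intro finite_PiE ladder1_finite ladders_ladder1[OF assms]) simp
  then show ?thesis
    using bij_betw_finite[OF bij_betw_ladder_face[OF assms]] by blast
qed

lemma sum_prod_ladder_face:
  fixes k :: "'n::finite \<Rightarrow> real \<Rightarrow> real"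
  assumes "Y \<in> ladders"
  shows "(\<Sum>y\<in>ladder_face Y u. \<Prod>i\<in>u. k i (y $ i)) = (\<Prod>i\<in>u. \<Sum>t\<in>Y i. k i t)"
proof -
  have "(\<Sum>y\<in>ladder_face Y u. \<Prod>i\<in>u. k i (y $ i)) = (\<Sum>g\<in>PiE u Y. \<Prod>i\<in>u. k i (g i))"
    by (subst sum.reindex_bij_betw[OF bij_betw_ladder_face[OF assms], symmetric]) simp
  also have "\<dots> = (\<Prod>i\<in>u. \<Sum>t\<in>Y i. k i t)"
    by (rule prod_sum_PiE[symmetric]) (auto simp: ladder1_finite ladders_ladder1[OF assms])
  finally show ?thesis .
qed

text \<open>
  On functions with separated variables the alternating sum factorises: each coordinate in \<open>u\<close>
  contributes an increment, each other one a value.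
\<close>

lemma Delta_prod:
  fixes g :: "'n::finite \<Rightarrow> real \<Rightarrow> real"
  shows "Delta u (\<lambda>x. \<Prod>i\<in>UNIV. g i (x $ i)) a b =
    (\<Prod>i\<in>u. g i (b $ i) - g i (a $ i)) * (\<Prod>i\<in>-u. g i (b $ i))"
proof -
  have split: "(\<Prod>i\<in>UNIV. g i (glue a v b $ i)) =
      (\<Prod>i\<in>v. g i (a $ i)) * (\<Prod>i\<in>u - v. g i (b $ i)) * (\<Prod>i\<in>-u. g i (b $ i))" if "v \<subseteq> u" for v
  proof -
    have "(\<Prod>i\<in>UNIV. g i (glue a v b $ i)) = (\<Prod>i\<in>v. g i (glue a v b $ i)) *
      (\<Prod>i\<in>u - v. g i (glue a v b $ i)) * (\<Prod>i\<in>-u. g i (glue a v b $ i))"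
    proof -
      have "prod h UNIV = prod h v * prod h (u - v) * prod h (-u)" for h :: "'n \<Rightarrow> real"
      proof -
        have "prod h UNIV = prod h u * prod h (-u)"
          using prod.subset_diff[of u UNIV h] by (simp add: Compl_eq_Diff_UNIV mult.commute)
        also have "prod h u = prod h v * prod h (u - v)"
          using prod.subset_diff[OF that, of h] by (simp add: mult.commute)
        finally show ?thesis .
      qed
      then show ?thesis .
    qed
    also have "\<dots> = (\<Prod>i\<in>v. g i (a $ i)) * (\<Prod>i\<in>u - v. g i (b $ i)) * (\<Prod>i\<in>-u. g i (b $ i))"
      using that by (intro arg_cong2[where f="(*)"] prod.cong) auto
    finally show ?thesis .
  qed
  have "Delta u (\<lambda>x. \<Prod>i\<in>UNIV. g i (x $ i)) a b =
     (\<Sum>v\<in>Pow u. ((-1) ^ card v * (\<Prod>i\<in>v. g i (a $ i)) * (\<Prod>i\<in>u - v. g i (b $ i))) * (\<Prod>i\<in>-u. g i (b $ i)))"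
    unfolding Delta_def by (intro sum.cong refl) (simp only: split Pow_iff mult.assoc)
  also have "\<dots> = (\<Prod>i\<in>u. g i (b $ i) - g i (a $ i)) * (\<Prod>i\<in>-u. g i (b $ i))"
    by (subst prod_diff_conv_sum) (simp_all add: sum_distrib_right)
  finally show ?thesis .
qed

lemma Delta_cong:
  assumes "\<And>v. v \<subseteq> u \<Longrightarrow> f (glue a v b) = g (glue a v b)"
  shows "Delta u f a b = Delta u g a b"
  unfolding Delta_def using assms by (intro sum.cong) auto

lemma Delta_sum:
  "Delta u (\<lambda>x. \<Sum>k\<in>K. c k * h k x) a b = (\<Sum>k\<in>K. c k * Delta u (h k) a b)"
proof -
  have "Delta u (\<lambda>x. \<Sum>k\<in>K. c k * h k x) a b =
      (\<Sum>v\<in>Pow u. \<Sum>k\<in>K. c k * ((-1) ^ card v * h k (glue a v b)))"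
    unfolding Delta_def by (simp add: sum_distrib_left mult_ac)
  also have "\<dots> = (\<Sum>k\<in>K. c k * Delta u (h k) a b)"
    unfolding Delta_def by (subst sum.swap) (simp add: sum_distrib_left)
  finally show ?thesis .
qed

lemma Delta_tendsto:
  assumes "\<And>v. v \<subseteq> u \<Longrightarrow> (\<lambda>k. h k (glue a v b)) \<longlonglongrightarrow> f (glue a v b)"
  shows "(\<lambda>k. Delta u (h k) a b) \<longlonglongrightarrow> Delta u f a b"
  unfolding Delta_def using assms by (intro tendsto_intros) auto

text \<open>
  The lower left corners of the cells that tile \<open>[p,1]\<close> inside the face \<open>u\<close>, when \<open>p\<close> is a grid point.
\<close>

definition face_cut :: "('n \<Rightarrow> real set) \<Rightarrow> 'n set \<Rightarrow> real^'n \<Rightarrow> (real^'n) set" where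
  "face_cut Y u p = {y \<in> ladder_face Y u. \<forall>i\<in>u. p $ i \<le> y $ i}"

text \<open>
  For separated variables the identity reads \<open>g\<^sub>i(p\<^sub>i) = g\<^sub>i(1) - (g\<^sub>i(1) - g\<^sub>i(p\<^sub>i))\<close> in every
  coordinate; multiplying out gives the sum over \<open>u\<close>, and one-dimensional telescoping replaces
  \<open>g\<^sub>i(1) - g\<^sub>i(p\<^sub>i)\<close> by ladder steps.
\<close>

lemma grid_telescope_prod:
  fixes g :: "'n::finite \<Rightarrow> real \<Rightarrow> real"
  assumes Y: "Y \<in> ladders" and p: "p \<in> grid Y"
  defines "F \<equiv> \<lambda>x :: real^'n. \<Prod>i\<in>UNIV. g i (x $ i)"
  shows "F p = (\<Sum>u\<in>UNIV. (-1) ^ card u * (\<Sum>y\<in>face_cut Y u p. Delta u F y (ladder_succ Y u y)))"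
proof -
  have tel: "(\<Sum>t\<in>Y i. if p $ i \<le> t then g i (succ1 (Y i) t) - g i t else 0) = g i 1 - g i (p $ i)" for i
  proof -
    have "p $ i \<in> insert 1 (Y i)" using p by (simp add: grid_def)
    from ladder1_telescope[OF ladders_ladder1[OF Y] this, of "g i"]
    show ?thesis
      by (subst sum.inter_filter[symmetric]) (auto intro: ladder1_finite ladders_ladder1[OF Y])
  qed
  have face: "(\<Sum>y\<in>face_cut Y u p. Delta u F y (ladder_succ Y u y)) =
      (\<Prod>i\<in>u. g i 1 - g i (p $ i)) * (\<Prod>i\<in>-u. g i 1)" for u
  proof -
    have "(\<Sum>y\<in>face_cut Y u p. Delta u F y (ladder_succ Y u y)) =
        (\<Sum>y\<in>ladder_face Y u. if \<forall>i\<in>u. p $ i \<le> y $ i then Delta u F y (ladder_succ Y u y) else 0)"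
      unfolding face_cut_def by (rule sum.inter_filter[OF finite_ladder_face[OF Y]])
    also have "\<dots> = (\<Sum>y\<in>ladder_face Y u.
        (\<Prod>i\<in>u. if p $ i \<le> y $ i then g i (succ1 (Y i) (y $ i)) - g i (y $ i) else 0) * (\<Prod>i\<in>-u. g i 1))"
    proof (intro sum.cong refl)
      fix y assume y: "y \<in> ladder_face Y u"
      have out: "(\<Prod>i\<in>-u. g i (ladder_succ Y u y $ i)) = (\<Prod>i\<in>-u. g i 1)"
        using y by (intro prod.cong) (auto simp: ladder_face_nth)
      show "(if \<forall>i\<in>u. p $ i \<le> y $ i then Delta u F y (ladder_succ Y u y) else 0) =
        (\<Prod>i\<in>u. if p $ i \<le> y $ i then g i (succ1 (Y i) (y $ i)) - g i (y $ i) else 0) * (\<Prod>i\<in>-u. g i 1)"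
        unfolding F_def Delta_prod out
        by (auto intro!: arg_cong2[where f="(*)"] prod.cong)
    qed
    also have "\<dots> = (\<Prod>i\<in>u. g i 1 - g i (p $ i)) * (\<Prod>i\<in>-u. g i 1)"
      by (subst sum_distrib_right[symmetric],
          subst sum_prod_ladder_face[OF Y,
            where k = "\<lambda>i t. if p $ i \<le> t then g i (succ1 (Y i) t) - g i t else 0"])
         (simp add: tel)
    finally show ?thesis .
  qed
  have "F p = (\<Prod>i\<in>UNIV. g i 1 - (g i 1 - g i (p $ i)))"
    by (simp add: F_def)
  also have "\<dots> = (\<Sum>u\<in>Pow UNIV. (-1) ^ card u * (\<Prod>i\<in>u. g i 1 - g i (p $ i)) * (\<Prod>i\<in>UNIV - u. g i 1))"
    by (rule prod_diff_conv_sum) simp_all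
  finally show ?thesis
    by (simp add: face Compl_eq_Diff_UNIV mult.assoc)
qed

text \<open>
  On a finite grid every function is a combination of point indicators, which have separated variables.
  An identity that is linear in \<open>f\<close> and only involves grid points thus reduces to such products.
\<close>

lemma grid_expansion:
  fixes f :: "real^'n::finite \<Rightarrow> real"
  assumes Y: "Y \<in> ladders" and x: "x \<in> grid Y"
  shows "f x = (\<Sum>q\<in>PiE UNIV (\<lambda>i. insert 1 (Y i)). f (\<chi> i. q i) * (\<Prod>i\<in>UNIV. of_bool (x $ i = q i)))"
proof -
  have "(\<Prod>i\<in>UNIV. of_bool (x $ i = q i)) = (of_bool (q = (\<lambda>i. x $ i)) :: real)" for q
  proof (cases "q = (\<lambda>i. x $ i)")
    case False
    then obtain i where "x $ i \<noteq> q i" by (metis ext)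
    then show ?thesis using False by (subst prod_zero) auto
  qed simp
  moreover have "(\<lambda>i. x $ i) \<in> PiE UNIV (\<lambda>i. insert 1 (Y i))"
    using x by (auto simp: grid_def)
  moreover have "finite (PiE UNIV (\<lambda>i. insert 1 (Y i)))"
    by (intro finite_PiE) (auto simp: ladder1_finite ladders_ladder1[OF Y])
  ultimately show ?thesis
    by (simp add: of_bool_def if_distrib[of "\<lambda>z. _ * z"] sum.delta cong: if_cong)
qed

lemma grid_telescope:
  fixes f :: "real^'n::finite \<Rightarrow> real"
  assumes Y: "Y \<in> ladders" and p: "p \<in> grid Y"
  shows "f p = (\<Sum>u\<in>UNIV. (-1) ^ card u * (\<Sum>y\<in>face_cut Y u p. Delta u f y (ladder_succ Y u y)))"
proof -
  let ?Q = "PiE UNIV (\<lambda>i. insert 1 (Y i))"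
  let ?F = "\<lambda>q x :: real^'n. \<Prod>i\<in>UNIV. of_bool (x $ i = q i) :: real"
  have D: "Delta u f y (ladder_succ Y u y) =
      (\<Sum>q\<in>?Q. f (\<chi> i. q i) * Delta u (?F q) y (ladder_succ Y u y))" if "y \<in> face_cut Y u p" for u y
  proof -
    have "y \<in> ladder_face Y u" using that by (simp add: face_cut_def)
    then have "Delta u f y (ladder_succ Y u y) =
        Delta u (\<lambda>x. \<Sum>q\<in>?Q. f (\<chi> i. q i) * ?F q x) y (ladder_succ Y u y)"
      by (intro Delta_cong grid_expansion[OF Y] grid_glue ladder_face_grid ladder_succ_grid[OF Y])
    then show ?thesis by (simp only: Delta_sum)
  qed
  have "f p = (\<Sum>q\<in>?Q. f (\<chi> i. q i) * ?F q p)"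
    by (rule grid_expansion[OF Y p])
  also have "\<dots> = (\<Sum>q\<in>?Q. f (\<chi> i. q i) *
      (\<Sum>u\<in>UNIV. (-1) ^ card u * (\<Sum>y\<in>face_cut Y u p. Delta u (?F q) y (ladder_succ Y u y))))"
    by (intro sum.cong refl arg_cong2[where f="(*)"] grid_telescope_prod[OF Y p])
  also have "\<dots> = (\<Sum>u\<in>UNIV. \<Sum>q\<in>?Q. (-1) ^ card u *
      (\<Sum>y\<in>face_cut Y u p. f (\<chi> i. q i) * Delta u (?F q) y (ladder_succ Y u y)))"
    by (subst sum.swap) (simp add: sum_distrib_left mult_ac)
  also have "\<dots> = (\<Sum>u\<in>UNIV. (-1) ^ card u * (\<Sum>y\<in>face_cut Y u p. Delta u f y (ladder_succ Y u y)))"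
    by (simp add: D sum_distrib_left sum.swap[of _ ?Q])
  finally show ?thesis .
qed

section \<open>Hardy--Krause variation is at most the \<open>Rstar\<close>-variation\<close>

text \<open>
  The indicator function of a box is a product of antitone functions \<open>g\<^sub>i\<close> with values \<open>0\<close> and
  \<open>1\<close>. By monotonicity the absolute increments telescope, whatever the ladder, to
  \<open>\<Prod>\<^bsub>i\<in>u\<^esub> (g\<^sub>i(0) - g\<^sub>i(1)) \<Prod>\<^bsub>i\<notin>u\<^esub> g\<^sub>i(1)\<close>. Summing over all \<open>u\<close> gives
  \<open>\<Prod>\<^sub>i g\<^sub>i(0)\<close>, from which the term of \<open>u = {}\<close> has to be subtracted.
\<close>

lemma Rstar_box_variation:
  fixes A :: "(real^'n::finite) set"
  assumes "A \<in> Rstar"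
  obtains c where "\<And>u. 0 \<le> c u"
    and "\<And>Y u. Y \<in> ladders \<Longrightarrow> ladder_variation Y u (indicat_real A) = c u"
    and "(\<Sum>u\<in>{u. u \<noteq> {}}. c u) = indicat_real A 0 - indicat_real A 1"
proof -
  obtain a v where A: "A = anchored_box a v" and a: "a \<in> cbox 0 1"
    using assms by (auto simp: Rstar_def)
  define g :: "'n \<Rightarrow> real \<Rightarrow> real"
    where "g i t = of_bool (0 \<le> t \<and> (if i \<in> v then t \<le> a $ i else t < a $ i))" for i t
  have g_anti: "g i t \<le> g i s" if "0 \<le> s" "s \<le> t" for i s t
    using that by (auto simp: g_def)
  have ind: "indicat_real A = (\<lambda>x. \<Prod>i\<in>UNIV. g i (x $ i))"
  proof
    fix x show "indicat_real A x = (\<Prod>i\<in>UNIV. g i (x $ i))"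
    proof (cases "x \<in> A")
      case True
      then have "g i (x $ i) = 1" for i by (simp add: A anchored_box_def g_def)
      then show ?thesis using True by simp
    next
      case False
      then obtain i where "\<not> (0 \<le> x $ i \<and> (if i \<in> v then x $ i \<le> a $ i else x $ i < a $ i))"
        unfolding A anchored_box_def by blast
      then have "g i (x $ i) = 0" by (simp only: g_def of_bool_eq)
      then have "(\<Prod>i\<in>UNIV. g i (x $ i)) = 0" by (intro prod_zero) auto
      then show ?thesis using False by simp
    qed
  qed
  define c where "c u = (\<Prod>i\<in>u. g i 0 - g i 1) * (\<Prod>i\<in>-u. g i 1)" for u
  have "0 \<le> c u" for u
    unfolding c_def using g_anti[of 0 1] by (intro mult_nonneg_nonneg prod_nonneg) (auto simp: g_def)
  moreover have "ladder_variation Y u (indicat_real A) = c u" if Y: "Y \<in> ladders" for Y u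
  proof -
    have "\<bar>Delta u (indicat_real A) y (ladder_succ Y u y)\<bar> =
        (\<Prod>i\<in>u. g i (y $ i) - g i (succ1 (Y i) (y $ i))) * (\<Prod>i\<in>-u. g i 1)"
      if y: "y \<in> ladder_face Y u" for y
    proof -
      have out: "(\<Prod>i\<in>-u. g i (ladder_succ Y u y $ i)) = (\<Prod>i\<in>-u. g i 1)"
        using y by (intro prod.cong) (auto simp: ladder_face_nth)
      have "\<bar>g i (succ1 (Y i) (y $ i)) - g i (y $ i)\<bar> = g i (y $ i) - g i (succ1 (Y i) (y $ i))"
        if "i \<in> u" for i
      proof -
        have m: "y $ i \<in> Y i" using y that by (simp add: ladder_face_nth)
        then have "0 \<le> y $ i" using ladders_ladder1[OF Y, of i] by (auto simp: ladder1_def)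
        then show ?thesis
          using g_anti[of "y $ i" "succ1 (Y i) (y $ i)" i] succ1_gt[OF ladders_ladder1[OF Y] m] by simp
      qed
      moreover have "\<bar>g i 1\<bar> = g i 1" for i by (simp add: g_def)
      ultimately show ?thesis
        unfolding ind Delta_prod out by (simp add: abs_mult abs_prod)
    qed
    then have "ladder_variation Y u (indicat_real A) =
        (\<Prod>i\<in>u. \<Sum>t\<in>Y i. g i t - g i (succ1 (Y i) t)) * (\<Prod>i\<in>-u. g i 1)"
      unfolding ladder_variation_def
      by (simp add: sum_prod_ladder_face[OF Y, symmetric] sum_distrib_right)
    moreover have "(\<Sum>t\<in>Y i. g i t - g i (succ1 (Y i) t)) = g i 0 - g i 1" for i
    proof -
      have "0 \<in> insert 1 (Y i)" "{t \<in> Y i. 0 \<le> t} = Y i"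
        using ladders_ladder1[OF Y, of i] by (auto simp: ladder1_def)
      then show ?thesis
        using ladder1_telescope[OF ladders_ladder1[OF Y], of 0 i "\<lambda>t. - g i t"] by simp
    qed
    ultimately show ?thesis by (simp add: c_def)
  qed
  moreover have "(\<Sum>u\<in>{u. u \<noteq> {}}. c u) = indicat_real A 0 - indicat_real A 1"
  proof -
    have "(\<Prod>i\<in>UNIV. (g i 0 - g i 1) + g i 1) = (\<Sum>u\<in>Pow UNIV. c u)"
      unfolding c_def Compl_eq_Diff_UNIV by (rule prod_add) simp
    also have "\<dots> = c {} + (\<Sum>u\<in>{u. u \<noteq> {}}. c u)"
      using sum.remove[of UNIV "{}" c] by (simp add: Compl_eq_Diff_UNIV[symmetric] set_diff_eq)
    finally show ?thesis by (simp add: ind c_def)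
  qed
  ultimately show ?thesis using that by blast
qed

lemma harman_Rstar_le_1:
  assumes "A \<in> Rstar" shows "harman Rstar A \<le> 1"
proof -
  have "harman_rep Rstar A 1"
    unfolding harman_rep_def using assms Rstar_subset
    by (intro exI[of _ 1] exI[of _ "\<lambda>_. A"]) auto
  then show ?thesis unfolding harman_def by (auto intro: Least_le)
qed

text \<open>
  A box contains \<open>1\<close> only if it is the whole cube. The Harman complexity is at least \<open>1\<close>
  in all other nonempty cases because an empty combination represents only the zero function.
\<close>

lemma Rstar_endpoints_le_harman:
  fixes A :: "(real^'n::finite) set"
  assumes A: "A \<in> Rstar"
  shows "indicat_real A 0 - indicat_real A 1 \<le> real (harman Rstar A)"
proof (cases "A = {} \<or> A = cbox 0 1")
  case True
  then show ?thesis by (auto simp: mem_box_cart)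
next
  case False
  have "harman_rep Rstar A (harman Rstar A)"
    using False LeastI_ex[OF harman_rep_exists[OF Rstar_subset algebraic_sum_member[OF Rstar_subset A]]]
    by (simp add: harman_def)
  moreover have "\<not> harman_rep Rstar A 0"
  proof
    assume "harman_rep Rstar A 0"
    then have "\<forall>x\<in>cbox 0 1. indicat_real A x = 0" by (auto simp: harman_rep_def)
    moreover have "A \<subseteq> cbox 0 1" using A Rstar_subset by blast
    ultimately show False using False by (auto simp: indicator_def split: if_splits)
  qed
  ultimately have "1 \<le> harman Rstar A" by (cases "harman Rstar A") auto
  then show ?thesis by (auto simp: indicator_def)
qed

lemma ladder_variation_nonneg: "0 \<le> ladder_variation Y u f"
  by (simp add: ladder_variation_def sum_nonneg)

lemma ladder_variation_simple_rep:
  assumes Y: "Y \<in> ladders" and rep: "simple_rep D f m \<alpha> A"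
  shows "ladder_variation Y u f \<le> (\<Sum>i=1..m. \<bar>\<alpha> i\<bar> * ladder_variation Y u (indicat_real (A i)))"
proof -
  have "\<bar>Delta u f y (ladder_succ Y u y)\<bar> \<le>
      (\<Sum>i=1..m. \<bar>\<alpha> i\<bar> * \<bar>Delta u (indicat_real (A i)) y (ladder_succ Y u y)\<bar>)"
    if y: "y \<in> ladder_face Y u" for y
  proof -
    have "Delta u f y (ladder_succ Y u y) =
        Delta u (\<lambda>x. \<Sum>i=1..m. \<alpha> i * indicat_real (A i) x) y (ladder_succ Y u y)"
      using rep unfolding simple_rep_def
      by (intro Delta_cong)
         (use grid_cbox[OF Y grid_glue[OF ladder_face_grid ladder_succ_grid[OF Y]]] y in blast)
    also have "\<dots> = (\<Sum>i=1..m. \<alpha> i * Delta u (indicat_real (A i)) y (ladder_succ Y u y))"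
      by (rule Delta_sum)
    finally show ?thesis
      by (simp add: abs_mult[symmetric] sum_abs)
  qed
  then have "ladder_variation Y u f \<le> (\<Sum>y\<in>ladder_face Y u.
      (\<Sum>i=1..m. \<bar>\<alpha> i\<bar> * \<bar>Delta u (indicat_real (A i)) y (ladder_succ Y u y)\<bar>))"
    unfolding ladder_variation_def by (rule sum_mono)
  also have "\<dots> = (\<Sum>i=1..m. \<bar>\<alpha> i\<bar> * ladder_variation Y u (indicat_real (A i)))"
    unfolding ladder_variation_def by (subst sum.swap) (simp add: sum_distrib_left)
  finally show ?thesis .
qed

lemma HK_le_V_simple:
  fixes f :: "real^'n::finite \<Rightarrow> real"
  shows "HK f \<le> V_simple Rstar f"
  unfolding V_simple_def
proof (rule Inf_greatest, clarify)
  fix m \<alpha> A assume rep: "simple_rep Rstar f m \<alpha> A"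
  have "\<forall>i\<in>{1..m}. \<exists>c. (\<forall>u. 0 \<le> c u) \<and>
      (\<forall>Y\<in>ladders. \<forall>u. ladder_variation Y u (indicat_real (A i)) = c u) \<and>
      (\<Sum>u\<in>{u. u \<noteq> {}}. c u) \<le> real (harman Rstar (A i))"
  proof
    fix i assume "i \<in> {1..m}"
    then have Ai: "A i \<in> Rstar" using rep by (simp add: simple_rep_def)
    from Rstar_box_variation[OF Ai] Rstar_endpoints_le_harman[OF Ai]
    show "\<exists>c. (\<forall>u. 0 \<le> c u) \<and>
      (\<forall>Y\<in>ladders. \<forall>u. ladder_variation Y u (indicat_real (A i)) = c u) \<and>
      (\<Sum>u\<in>{u. u \<noteq> {}}. c u) \<le> real (harman Rstar (A i))"
      by metis
  qed
  then obtain c where c0: "\<And>i u. i \<in> {1..m} \<Longrightarrow> 0 \<le> c i u"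
    and cV: "\<And>i u Y. i \<in> {1..m} \<Longrightarrow> Y \<in> ladders \<Longrightarrow> ladder_variation Y u (indicat_real (A i)) = c i u"
    and ch: "\<And>i. i \<in> {1..m} \<Longrightarrow> (\<Sum>u\<in>{u. u \<noteq> {}}. c i u) \<le> real (harman Rstar (A i))"
    by (metis (no_types, lifting) bchoice)
  have sup: "(SUP Y\<in>ladders. ennreal (ladder_variation Y u f)) \<le> ennreal (\<Sum>i=1..m. \<bar>\<alpha> i\<bar> * c i u)" for u
  proof (rule SUP_least)
    fix Y :: "'n \<Rightarrow> real set" assume Y: "Y \<in> ladders"
    have "(\<Sum>i=1..m. \<bar>\<alpha> i\<bar> * ladder_variation Y u (indicat_real (A i))) = (\<Sum>i=1..m. \<bar>\<alpha> i\<bar> * c i u)"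
      by (intro sum.cong refl) (simp only: cV[OF _ Y])
    then show "ennreal (ladder_variation Y u f) \<le> ennreal (\<Sum>i=1..m. \<bar>\<alpha> i\<bar> * c i u)"
      using ladder_variation_simple_rep[OF Y rep, of u] by (intro ennreal_leI) simp
  qed
  have "HK f \<le> (\<Sum>u\<in>{u. u \<noteq> {}}. ennreal (\<Sum>i=1..m. \<bar>\<alpha> i\<bar> * c i u))"
    unfolding HK_def by (intro sum_mono sup)
  also have "\<dots> = ennreal (\<Sum>u\<in>{u. u \<noteq> {}}. \<Sum>i=1..m. \<bar>\<alpha> i\<bar> * c i u)"
    by (intro sum_ennreal sum_nonneg mult_nonneg_nonneg c0) auto
  also have "\<dots> = ennreal (\<Sum>i=1..m. \<bar>\<alpha> i\<bar> * (\<Sum>u\<in>{u. u \<noteq> {}}. c i u))"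
    by (subst sum.swap) (simp add: sum_distrib_left)
  also have "\<dots> \<le> ennreal (\<Sum>i=1..m. \<bar>\<alpha> i\<bar> * real (harman Rstar (A i)))"
    by (intro ennreal_leI sum_mono mult_left_mono ch) auto
  finally show "HK f \<le> ennreal (\<Sum>i=1..m. \<bar>\<alpha> i\<bar> * real (harman Rstar (A i)))" .
qed

text \<open>
  A single ladder variation involves finitely many values of the function and is continuous; suprema of
  continuous functionals are lower semicontinuous. Fatou's lemma for the counting measure on the sets
  \<open>u\<close> moves the limit inferior out of the finite sum.
\<close>

lemma HK_le_liminf:
  fixes f :: "real^'n::finite \<Rightarrow> real"
  assumes lim: "\<And>x. x \<in> cbox 0 1 \<Longrightarrow> (\<lambda>k. h k x) \<longlonglongrightarrow> f x"
  shows "HK f \<le> liminf (\<lambda>k. HK (h k))"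
proof -
  define S where "S f u = (SUP Y\<in>ladders. ennreal (ladder_variation Y u f))"
    for f :: "real^'n \<Rightarrow> real" and u
  have fin: "finite {u :: 'n set. u \<noteq> {}}" by simp
  have S: "S f u \<le> liminf (\<lambda>k. S (h k) u)" for u
    unfolding S_def
  proof (rule SUP_least)
    fix Y :: "'n \<Rightarrow> real set" assume Y: "Y \<in> ladders"
    have "(\<lambda>k. ladder_variation Y u (h k)) \<longlonglongrightarrow> ladder_variation Y u f"
      unfolding ladder_variation_def
      by (intro tendsto_sum tendsto_rabs Delta_tendsto lim grid_cbox[OF Y] grid_glue
          ladder_face_grid ladder_succ_grid[OF Y])
    then have "(\<lambda>k. ennreal (ladder_variation Y u (h k))) \<longlonglongrightarrow> ennreal (ladder_variation Y u f)"
      by (rule tendsto_ennrealI)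
    then have "ennreal (ladder_variation Y u f) = liminf (\<lambda>k. ennreal (ladder_variation Y u (h k)))"
      by (intro lim_imp_Liminf[symmetric]) auto
    also have "\<dots> \<le> liminf (\<lambda>k. SUP Y\<in>ladders. ennreal (ladder_variation Y u (h k)))"
      using Y by (intro Liminf_mono always_eventually allI SUP_upper)
    finally show "ennreal (ladder_variation Y u f) \<le>
      liminf (\<lambda>k. SUP Y\<in>ladders. ennreal (ladder_variation Y u (h k)))" .
  qed
  have "HK f \<le> (\<Sum>u\<in>{u. u \<noteq> {}}. liminf (\<lambda>k. S (h k) u))"
    unfolding HK_def S_def[symmetric] by (intro sum_mono S)
  also have "\<dots> \<le> liminf (\<lambda>k. HK (h k))"
    using nn_integral_liminf[of "\<lambda>k u. S (h k) u" "count_space {u. u \<noteq> {}}"]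
    by (simp add: nn_integral_count_space_finite[OF fin] HK_def S_def)
  finally show ?thesis .
qed

lemma HK_le_V_var:
  fixes f :: "real^'n::finite \<Rightarrow> real"
  shows "HK f \<le> V_var Rstar f"
proof -
  have "HK f \<le> liminf (\<lambda>i. V_simple Rstar (g i))" if g: "g \<in> approx_seqs Rstar f" for g
  proof -
    have "HK f \<le> liminf (\<lambda>i. HK (g i))"
      using g by (intro HK_le_liminf) (auto simp: approx_seqs_def intro: tendsto_uniform_limitI)
    also have "\<dots> \<le> liminf (\<lambda>i. V_simple Rstar (g i))"
      by (intro Liminf_mono always_eventually allI HK_le_V_simple)
    finally show ?thesis .
  qed
  then show ?thesis by (auto simp: V_var_def intro: INF_greatest)
qed

section \<open>Uniform approximation of functions of bounded Hardy--Krause variation\<close>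

text \<open>
  The part of the total ladder variation that sees the \<open>j\<close>-th coordinate move between \<open>s\<close> and
  \<open>t\<close>: the faces with \<open>j \<in> u\<close> and, in them, the cells whose corner lies in the slab.
\<close>

definition slab_variation ::
    "('n \<Rightarrow> real set) \<Rightarrow> 'n \<Rightarrow> real \<Rightarrow> real \<Rightarrow> (real^'n \<Rightarrow> real) \<Rightarrow> real" where
  "slab_variation Y j s t f = (\<Sum>u\<in>{u. j \<in> u}.
     \<Sum>y\<in>{y \<in> ladder_face Y u. s \<le> y $ j \<and> y $ j < t}. \<bar>Delta u f y (ladder_succ Y u y)\<bar>)"

lemma slab_variation_nonneg: "0 \<le> slab_variation Y j s t f"
  by (simp add: slab_variation_def sum_nonneg)

lemma slab_variation_superadditive:
  fixes Y :: "'n::finite \<Rightarrow> real set"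
  assumes Y: "Y \<in> ladders" and "r \<le> s" "s \<le> s'" "s' \<le> t"
  shows "slab_variation Y j r s f + slab_variation Y j s s' f \<le> slab_variation Y j r t f"
  unfolding slab_variation_def sum.distrib[symmetric]
proof (intro sum_mono)
  fix u :: "'n set"
  let ?S = "\<lambda>s t. {y \<in> ladder_face Y u. s \<le> y $ j \<and> y $ j < t}"
  let ?h = "\<lambda>y. \<bar>Delta u f y (ladder_succ Y u y)\<bar>"
  have "sum ?h (?S r s) + sum ?h (?S s s') = sum ?h (?S r s \<union> ?S s s')"
    using finite_ladder_face[OF Y, of u] by (intro sum.union_disjoint[symmetric]) auto
  also have "\<dots> \<le> sum ?h (?S r t)"
    using finite_ladder_face[OF Y, of u] assms by (intro sum_mono2) auto
  finally show "sum ?h (?S r s) + sum ?h (?S s s') \<le> sum ?h (?S r t)" .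
qed

lemma slab_variation_le_total:
  fixes Y :: "'n::finite \<Rightarrow> real set"
  assumes Y: "Y \<in> ladders"
  shows "slab_variation Y j s t f \<le> (\<Sum>u\<in>{u. u \<noteq> {}}. ladder_variation Y u f)"
proof -
  have "slab_variation Y j s t f \<le> (\<Sum>u\<in>{u. j \<in> u}. ladder_variation Y u f)"
    unfolding slab_variation_def ladder_variation_def
    using finite_ladder_face[OF Y] by (intro sum_mono sum_mono2) auto
  also have "\<dots> \<le> (\<Sum>u\<in>{u. u \<noteq> {}}. ladder_variation Y u f)"
    by (intro sum_mono2) (auto simp: ladder_variation_nonneg)
  finally show ?thesis .
qed

text \<open>
  Subtract the telescoping identities at \<open>p\<close> and \<open>q\<close>. Faces with \<open>j \<notin> u\<close> do not distinguish the
  two points, and in the others only the cells of the slab between them remain.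
\<close>

lemma increment_le_slab_variation:
  fixes f :: "real^'n::finite \<Rightarrow> real"
  assumes Y: "Y \<in> ladders" and p: "p \<in> grid Y" and q: "q \<in> grid Y"
    and agree: "\<And>i. i \<noteq> j \<Longrightarrow> p $ i = q $ i" and le: "p $ j \<le> q $ j"
  shows "\<bar>f p - f q\<bar> \<le> slab_variation Y j (p $ j) (q $ j) f"
proof -
  let ?D = "\<lambda>u y. Delta u f y (ladder_succ Y u y)"
  let ?S = "\<lambda>u. {y \<in> ladder_face Y u. p $ j \<le> y $ j \<and> y $ j < q $ j}"
  have fin: "finite (ladder_face Y u)" for u by (rule finite_ladder_face[OF Y])
  have le': "p $ i \<le> q $ i" for i using agree[of i] le by (cases "i = j") auto
  have sub: "face_cut Y u q \<subseteq> face_cut Y u p" for u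
    unfolding face_cut_def using le' order_trans by blast
  have "f p - f q = (\<Sum>u\<in>UNIV. (-1) ^ card u * (sum (?D u) (face_cut Y u p) - sum (?D u) (face_cut Y u q)))"
    by (subst grid_telescope[OF Y p], subst grid_telescope[OF Y q])
       (simp add: right_diff_distrib sum_subtractf)
  also have "\<dots> = (\<Sum>u\<in>UNIV. (-1) ^ card u * sum (?D u) (face_cut Y u p - face_cut Y u q))"
    using sub fin by (subst sum_diff) (auto simp: face_cut_def)
  finally have "\<bar>f p - f q\<bar> \<le> (\<Sum>u\<in>UNIV. sum (\<lambda>y. \<bar>?D u y\<bar>) (face_cut Y u p - face_cut Y u q))"
    by (auto intro!: order_trans[OF sum_abs] sum_mono simp: abs_mult)
  also have "\<dots> = (\<Sum>u\<in>{u. j \<in> u}. sum (\<lambda>y. \<bar>?D u y\<bar>) (face_cut Y u p - face_cut Y u q))"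
  proof (intro sum.mono_neutral_right ballI)
    fix u assume "u \<in> UNIV - {u. j \<in> u}"
    then have "face_cut Y u p = face_cut Y u q"
      unfolding face_cut_def using agree by (metis (no_types, lifting) DiffD2 mem_Collect_eq)
    then show "sum (\<lambda>y. \<bar>?D u y\<bar>) (face_cut Y u p - face_cut Y u q) = 0" by simp
  qed auto
  also have "\<dots> \<le> slab_variation Y j (p $ j) (q $ j) f"
    unfolding slab_variation_def
  proof (intro sum_mono sum_mono2)
    fix u assume "u \<in> {u. j \<in> u}"
    then show "face_cut Y u p - face_cut Y u q \<subseteq> ?S u"
      unfolding face_cut_def using agree by (auto simp: not_le) (metis not_le)
  qed (use fin in auto)
  finally show ?thesis .
qed

lemma ladder_through:
  fixes F :: "(real^'n::finite) set"
  assumes "finite F" "F \<subseteq> cbox 0 1"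
  obtains Y where "Y \<in> ladders" "F \<subseteq> grid Y"
proof
  define Y where "Y i = insert 0 ((\<lambda>x. x $ i) ` F) - {1}" for i
  show "Y \<in> ladders"
    using assms by (fastforce simp: ladders_def ladder1_def Y_def mem_box_cart less_le)
  show "F \<subseteq> grid Y"
    by (auto simp: grid_def Y_def)
qed

text \<open>
  \<open>jumps f e j n t\<close>: up to \<open>t\<close> there are \<open>n\<close> successive moves
  \<open>s\<^sub>1 < t\<^sub>1 \<le> s\<^sub>2 < t\<^sub>2 \<le> \<dots> \<le> t\<close> of the \<open>j\<close>-th coordinate, each of which changes \<open>f\<close>
  by more than \<open>e\<close> for a suitable choice of the other coordinates. That choice may differ from
  move to move.
\<close>

primrec jumps :: "(real^'n \<Rightarrow> real) \<Rightarrow> real \<Rightarrow> 'n \<Rightarrow> nat \<Rightarrow> real \<Rightarrow> bool" where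
  "jumps f e j 0 t \<longleftrightarrow> True"
| "jumps f e j (Suc n) t \<longleftrightarrow> (\<exists>p\<in>cbox 0 1. \<exists>q\<in>cbox 0 1. jumps f e j n (p $ j) \<and>
     p $ j < q $ j \<and> q $ j \<le> t \<and> (\<forall>i. i \<noteq> j \<longrightarrow> p $ i = q $ i) \<and> e < \<bar>f p - f q\<bar>)"

lemma jumps_mono: "jumps f e j n s \<Longrightarrow> s \<le> t \<Longrightarrow> jumps f e j n t"
  by (cases n) (auto intro: order_trans)

text \<open>
  The finite set \<open>F\<close> collects the end points of all moves. Any ladder whose grid contains them has the
  moves in disjoint slabs, and each slab carries a variation of more than \<open>e\<close>.
\<close>

lemma jumps_slab_variation:
  fixes f :: "real^'n::finite \<Rightarrow> real"
  assumes "jumps f e j n t"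
  shows "\<exists>F. finite F \<and> F \<subseteq> cbox 0 1 \<and>
    (\<forall>Y\<in>ladders. F \<subseteq> grid Y \<longrightarrow> real n * e \<le> slab_variation Y j 0 t f)"
  using assms
proof (induction n arbitrary: t)
  case 0
  then show ?case by (intro exI[of _ "{}"]) (auto simp: slab_variation_nonneg)
next
  case (Suc n)
  then obtain p q where p: "p \<in> cbox 0 1" and q: "q \<in> cbox 0 1" and J: "jumps f e j n (p $ j)"
    and pq: "p $ j < q $ j" "q $ j \<le> t" "\<And>i. i \<noteq> j \<Longrightarrow> p $ i = q $ i" and e: "e < \<bar>f p - f q\<bar>"
    by auto
  from Suc.IH[OF J] obtain F where F: "finite F" "F \<subseteq> cbox 0 1"
    and slab: "\<And>Y. Y \<in> ladders \<Longrightarrow> F \<subseteq> grid Y \<Longrightarrow> real n * e \<le> slab_variation Y j 0 (p $ j) f"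
    by blast
  have "real (Suc n) * e \<le> slab_variation Y j 0 t f"
    if Y: "Y \<in> ladders" and sub: "insert p (insert q F) \<subseteq> grid Y" for Y
  proof -
    have "real n * e \<le> slab_variation Y j 0 (p $ j) f"
      using slab[OF Y] sub by simp
    moreover have "\<bar>f p - f q\<bar> \<le> slab_variation Y j (p $ j) (q $ j) f"
      using sub pq by (intro increment_le_slab_variation[OF Y]) auto
    moreover have "slab_variation Y j 0 (p $ j) f + slab_variation Y j (p $ j) (q $ j) f
        \<le> slab_variation Y j 0 t f"
      using p pq by (intro slab_variation_superadditive[OF Y]) (auto simp: mem_box_cart)
    ultimately show ?thesis using e by (simp add: algebra_simps)
  qed
  then show ?case
    using F p q by (intro exI[of _ "insert p (insert q F)"]) auto
qed

text \<open>
  Let \<open>L t\<close> be the number of \<open>n\<close> with \<open>jumps f e j n t\<close>. It is bounded because \<open>n\<close> jumps force a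
  variation of at least \<open>n * e\<close>, it is monotone in \<open>t\<close>, and it grows over every change of \<open>f\<close> by more
  than \<open>e\<close>. So \<open>f\<close> changes by at most \<open>e\<close> on the level sets of \<open>L\<close>, which are finitely many intervals,
  and \<open>\<rho>\<close> sends each point to a fixed representative of its level set.
\<close>

lemma coordinate_quantizer:
  fixes f :: "real^'n::finite \<Rightarrow> real"
  assumes C: "\<And>Y. Y \<in> ladders \<Longrightarrow> (\<Sum>u\<in>{u. u \<noteq> {}}. ladder_variation Y u f) \<le> C" and e: "0 < e"
  shows "\<exists>\<rho>. mono_on {0..1} \<rho> \<and> \<rho> ` {0..1} \<subseteq> {0..1} \<and> finite (\<rho> ` {0..1}) \<and>
    (\<forall>p\<in>cbox 0 1. \<forall>q\<in>cbox 0 1. (\<forall>i. i \<noteq> j \<longrightarrow> p $ i = q $ i) \<longrightarrow> q $ j = \<rho> (p $ j) \<longrightarrow>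
      \<bar>f p - f q\<bar> \<le> e)"
proof -
  define N where "N t = {n. jumps f e j n t}" for t
  define L where "L t = card (N t)" for t
  obtain B where B: "C / e < real B" using reals_Archimedean2 by blast
  have bound: "n < B" if "jumps f e j n t" for n t
  proof -
    obtain F where F: "finite F" "F \<subseteq> cbox 0 1"
      "\<And>Y. Y \<in> ladders \<Longrightarrow> F \<subseteq> grid Y \<Longrightarrow> real n * e \<le> slab_variation Y j 0 t f"
      using jumps_slab_variation[OF \<open>jumps f e j n t\<close>] by blast
    obtain Y where Y: "Y \<in> ladders" "F \<subseteq> grid Y"
      using ladder_through[OF F(1,2)] .
    have "real n * e \<le> C"
      using F(3)[OF Y] slab_variation_le_total[OF Y(1), of j 0 t f] C[OF Y(1)] by linarith
    then have "real n \<le> C / e" using e by (simp add: field_simps)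
    then show ?thesis using B by linarith
  qed
  then have fin: "finite (N t)" and LB: "L t \<le> B" for t
  proof -
    have sub: "N t \<subseteq> {..<B}" using bound by (auto simp: N_def)
    then show "finite (N t)" using finite_subset by blast
    show "L t \<le> B" unfolding L_def using card_mono[OF _ sub] by simp
  qed
  have mono: "L s \<le> L t" if "s \<le> t" for s t
    unfolding L_def by (intro card_mono fin) (auto simp: N_def intro: jumps_mono[OF _ that])
  have jump: "L (p $ j) < L (q $ j)"
    if "p \<in> cbox 0 1" "q \<in> cbox 0 1" "p $ j < q $ j" "\<And>i. i \<noteq> j \<Longrightarrow> p $ i = q $ i" "e < \<bar>f p - f q\<bar>" for p q
  proof -
    \<comment> \<open>the move from \<open>p\<close> to \<open>q\<close> prolongs every chain of moves that ends before \<open>p\<close>\<close>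
    have "insert 0 (Suc ` N (p $ j)) \<subseteq> N (q $ j)"
    proof -
      have "jumps f e j (Suc n) (q $ j)" if "n \<in> N (p $ j)" for n
        using that \<open>p \<in> cbox 0 1\<close> \<open>q \<in> cbox 0 1\<close> \<open>p $ j < q $ j\<close> \<open>e < \<bar>f p - f q\<bar>\<close>
          \<open>\<And>i. i \<noteq> j \<Longrightarrow> p $ i = q $ i\<close> unfolding N_def jumps.simps by blast
      then show ?thesis by (auto simp: N_def)
    qed
    from card_mono[OF fin this] show ?thesis
      using fin by (simp add: L_def card_image)
  qed
  define \<rho> where "\<rho> t = (SOME s. s \<in> {0..1} \<and> L s = L t)" for t
  have \<rho>: "\<rho> t \<in> {0..1} \<and> L (\<rho> t) = L t" if "t \<in> {0..1}" for t
    unfolding \<rho>_def by (rule someI[of _ t]) (use that in simp)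
  show ?thesis
  proof (intro exI[of _ \<rho>] conjI ballI impI)
    show "mono_on {0..1} \<rho>"
    proof (rule mono_onI)
      fix s t :: real assume st: "s \<in> {0..1}" "t \<in> {0..1}" "s \<le> t"
      show "\<rho> s \<le> \<rho> t"
      proof (cases "L s = L t")
        case True
        then show ?thesis by (simp add: \<rho>_def)
      next
        case False
        then have "L (\<rho> s) < L (\<rho> t)" using mono[OF st(3)] \<rho> st by simp
        then show ?thesis using mono[of "\<rho> t" "\<rho> s"] by linarith
      qed
    qed
    show "\<rho> ` {0..1} \<subseteq> {0..1}" using \<rho> by blast
    have "\<rho> ` {0..1} \<subseteq> (\<lambda>n. SOME s. s \<in> {0..1} \<and> L s = n) ` {..B}"
      using LB by (auto simp: \<rho>_def)
    then show "finite (\<rho> ` {0..1})" using finite_surj by blast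
  next
    fix p q :: "real^'n"
    assume p: "p \<in> cbox 0 1" and q: "q \<in> cbox 0 1" and agree: "\<forall>i. i \<noteq> j \<longrightarrow> p $ i = q $ i"
      and qj: "q $ j = \<rho> (p $ j)"
    have L: "L (q $ j) = L (p $ j)"
      using \<rho>[of "p $ j"] p by (simp add: qj mem_box_cart)
    show "\<bar>f p - f q\<bar> \<le> e"
    proof (rule ccontr)
      assume far: "\<not> \<bar>f p - f q\<bar> \<le> e"
      consider "p $ j < q $ j" | "q $ j < p $ j" | "p = q"
        using agree by (metis linorder_neqE vec_eq_iff)
      then show False
      proof cases
        case 1
        then show False using jump[OF p q] agree far L by simp
      next
        case 2
        then show False using jump[OF q p] agree far L by (simp add: abs_minus_commute)
      next
        case 3
        then show False using far e by simp
      qed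
    qed
  qed
qed

text \<open>
  The empty segment is the half-open interval with \<open>c = 0\<close>.
\<close>

lemma initial_segment_unit_interval:
  fixes S :: "real set"
  assumes S: "S \<subseteq> {0..1}" and down: "\<And>x y. y \<in> S \<Longrightarrow> 0 \<le> x \<Longrightarrow> x \<le> y \<Longrightarrow> x \<in> S"
  obtains c where "c \<in> {0..1}" "S = {0..c} \<or> S = {0..<c}"
proof (cases "S = {}")
  case True
  then show ?thesis using that[of 0] by simp
next
  case False
  have bdd: "bdd_above S" using S by (meson bdd_above_Icc bdd_above_mono)
  obtain z where z: "z \<in> S" using False by blast
  have up: "x \<le> Sup S" if "x \<in> S" for x using that bdd by (rule cSup_upper)
  have "Sup S \<in> {0..1}"
    using cSup_least[OF False, of 1] up[OF z] z S by force
  moreover have "{0..<Sup S} \<subseteq> S"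
  proof
    fix x assume x: "x \<in> {0..<Sup S}"
    then obtain y where "y \<in> S" "x < y" using less_cSupD[OF False, of x] by auto
    then show "x \<in> S" using down[of y x] x by simp
  qed
  moreover have "S \<subseteq> {0..Sup S}" using up S by force
  ultimately have "S = {0..Sup S} \<or> S = {0..<Sup S}"
    by (cases "Sup S \<in> S") force+
  then show ?thesis using that \<open>Sup S \<in> {0..1}\<close> by blast
qed

lemma box_of_initial_segments_in_Rstar:
  fixes S :: "'n::finite \<Rightarrow> real set"
  assumes S: "\<And>i. S i \<subseteq> {0..1}" and down: "\<And>i x y. y \<in> S i \<Longrightarrow> 0 \<le> x \<Longrightarrow> x \<le> y \<Longrightarrow> x \<in> S i"
  shows "{x :: real^'n. \<forall>i. x $ i \<in> S i} \<in> Rstar"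
proof -
  have "\<exists>c. c \<in> {0..1} \<and> (S i = {0..c} \<or> S i = {0..<c})" for i
    by (rule initial_segment_unit_interval[OF S[of i]]) (use down in blast)+
  then obtain c where c: "\<And>i. c i \<in> {0..1}" "\<And>i. S i = {0..c i} \<or> S i = {0..<c i}"
    by metis
  define v where "v = {i. S i = {0..c i}}"
  have "(x $ i \<in> S i) \<longleftrightarrow> 0 \<le> x $ i \<and> (if i \<in> v then x $ i \<le> c i else x $ i < c i)" for x :: "real^'n" and i
  proof (cases "i \<in> v")
    case True
    then have "S i = {0..c i}" by (simp add: v_def)
    then show ?thesis using True by simp
  next
    case False
    then have "S i = {0..<c i}" using c(2)[of i] by (simp add: v_def)
    then show ?thesis using False by simp
  qed
  then have "{x :: real^'n. \<forall>i. x $ i \<in> S i} = anchored_box (\<chi> i. c i) v"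
    by (simp add: anchored_box_def)
  moreover have "(\<chi> i. c i) \<in> cbox 0 (1 :: real^'n)"
    using c(1) by (simp add: mem_box_cart)
  ultimately show ?thesis unfolding Rstar_def by blast
qed

lemma simple_finite_sum:
  fixes g :: "real^'n::finite \<Rightarrow> real"
  assumes K: "finite K" and A: "\<And>k. k \<in> K \<Longrightarrow> A k \<in> D"
    and g: "\<And>x. x \<in> cbox 0 1 \<Longrightarrow> g x = (\<Sum>k\<in>K. \<alpha> k * indicat_real (A k) x)"
  shows "g \<in> simple_space D"
    and "V_simple D g \<le> ennreal (\<Sum>k\<in>K. \<bar>\<alpha> k\<bar> * real (harman D (A k)))"
proof -
  obtain b where b: "bij_betw b {1..card K} K"
    using ex_bij_betw_nat_finite_1[OF K] by blast
  have rep: "simple_rep D g (card K) (\<alpha> \<circ> b) (A \<circ> b)"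
    unfolding simple_rep_def
  proof (intro conjI ballI)
    show "(A \<circ> b) i \<in> D" if "i \<in> {1..card K}" for i
      using A bij_betwE[OF b] that by simp
    show "g x = (\<Sum>i=1..card K. (\<alpha> \<circ> b) i * indicat_real ((A \<circ> b) i) x)" if "x \<in> cbox 0 1" for x
      using g[OF that] sum.reindex_bij_betw[OF b, of "\<lambda>k. \<alpha> k * indicat_real (A k) x"] by simp
  qed
  then show "g \<in> simple_space D" unfolding simple_space_def by blast
  have "V_simple D g \<le> ennreal (\<Sum>i=1..card K. \<bar>(\<alpha> \<circ> b) i\<bar> * real (harman D ((A \<circ> b) i)))"
    unfolding V_simple_def using rep by (intro Inf_lower) blast
  also have "(\<Sum>i=1..card K. \<bar>(\<alpha> \<circ> b) i\<bar> * real (harman D ((A \<circ> b) i))) =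
      (\<Sum>k\<in>K. \<bar>\<alpha> k\<bar> * real (harman D (A k)))"
    using sum.reindex_bij_betw[OF b, of "\<lambda>k. \<bar>\<alpha> k\<bar> * real (harman D (A k))"] by simp
  finally show "V_simple D g \<le> ennreal (\<Sum>k\<in>K. \<bar>\<alpha> k\<bar> * real (harman D (A k)))" .
qed

lemma sum_ladder_variation_le_HK:
  fixes f :: "real^'n::finite \<Rightarrow> real"
  assumes "Y \<in> ladders"
  shows "ennreal (\<Sum>u\<in>{u. u \<noteq> {}}. ladder_variation Y u f) \<le> HK f"
proof -
  have "ennreal (\<Sum>u\<in>{u. u \<noteq> {}}. ladder_variation Y u f) =
      (\<Sum>u\<in>{u. u \<noteq> {}}. ennreal (ladder_variation Y u f))"
    by (rule sum_ennreal[symmetric]) (rule ladder_variation_nonneg)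
  also have "\<dots> \<le> HK f"
    unfolding HK_def using assms by (intro sum_mono SUP_upper)
  finally show ?thesis .
qed

text \<open>
  The ladder consists of the values of the \<open>\<rho>\<^sub>i\<close>, with \<open>0\<close> added and \<open>1\<close> removed as a ladder demands.
  So \<open>\<rho>\<close> maps the cube to grid points, where the telescoping identity applies. The set attached to \<open>(u, y)\<close> collects the \<open>x\<close> for which the cell \<open>y\<close>
  contributes. The term of \<open>u = {}\<close> is the constant \<open>f(1)\<close>, carried by the whole cube, whose
  complexity is \<open>0\<close>.
\<close>

lemma quantized_function_simple:
  fixes f :: "real^'n::finite \<Rightarrow> real" and \<rho> :: "'n \<Rightarrow> real \<Rightarrow> real"
  assumes mono: "\<And>i. mono_on {0..1} (\<rho> i)" and range: "\<And>i. \<rho> i ` {0..1} \<subseteq> {0..1}"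
    and fin: "\<And>i. finite (\<rho> i ` {0..1})"
  defines "g \<equiv> \<lambda>x. f (\<chi> i. \<rho> i (x $ i))"
  shows "g \<in> simple_space Rstar" and "V_simple Rstar g \<le> HK f"
proof -
  define Y where "Y i = insert 0 (\<rho> i ` {0..1}) - {1}" for i
  have Y: "Y \<in> ladders"
    using range fin by (fastforce simp: ladders_def ladder1_def Y_def less_le)
  define A where "A = (\<lambda>(u, y). {x :: real^'n. \<forall>i. x $ i \<in> {t \<in> {0..1}. i \<in> u \<longrightarrow> \<rho> i t \<le> y $ i}})"
  define \<alpha> where "\<alpha> = (\<lambda>(u, y). (-1) ^ card u * Delta u f y (ladder_succ Y u y))"
  let ?K = "SIGMA u:UNIV. ladder_face Y u"
  have K: "finite ?K" by (intro finite_SigmaI finite_ladder_face[OF Y]) simp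
  have A: "A k \<in> Rstar" for k
    unfolding A_def case_prod_unfold
  proof (rule box_of_initial_segments_in_Rstar)
    fix i x y
    assume y: "y \<in> {t \<in> {0..1}. i \<in> fst k \<longrightarrow> \<rho> i t \<le> snd k $ i}" and x: "0 \<le> x" "x \<le> y"
    then have "\<rho> i x \<le> \<rho> i y" by (intro mono_onD[OF mono]) auto
    then show "x \<in> {t \<in> {0..1}. i \<in> fst k \<longrightarrow> \<rho> i t \<le> snd k $ i}" using x y by auto
  qed auto
  have g: "g x = (\<Sum>k\<in>?K. \<alpha> k * indicat_real (A k) x)" if x: "x \<in> cbox 0 1" for x
  proof -
    let ?p = "(\<chi> i. \<rho> i (x $ i)) :: real^'n"
    have x01: "x $ i \<in> {0..1}" for i using x by (simp add: mem_box_cart)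
    have p: "?p \<in> grid Y" using x01 by (auto simp: grid_def Y_def)
    have "g x = (\<Sum>u\<in>UNIV. (-1) ^ card u * (\<Sum>y\<in>face_cut Y u ?p. Delta u f y (ladder_succ Y u y)))"
      unfolding g_def by (rule grid_telescope[OF Y p])
    also have "\<dots> = (\<Sum>u\<in>UNIV. \<Sum>y\<in>ladder_face Y u. \<alpha> (u, y) * indicat_real (A (u, y)) x)"
    proof (intro sum.cong refl)
      fix u :: "'n set"
      have "(\<Sum>y\<in>face_cut Y u ?p. Delta u f y (ladder_succ Y u y)) =
        (\<Sum>y\<in>ladder_face Y u. if \<forall>i\<in>u. ?p $ i \<le> y $ i then Delta u f y (ladder_succ Y u y) else 0)"
        unfolding face_cut_def by (rule sum.inter_filter[OF finite_ladder_face[OF Y]])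
      also have "\<dots> = (\<Sum>y\<in>ladder_face Y u. Delta u f y (ladder_succ Y u y) * indicat_real (A (u, y)) x)"
        using x01 by (intro sum.cong refl) (auto simp: A_def indicator_def)
      finally show "(-1) ^ card u * (\<Sum>y\<in>face_cut Y u ?p. Delta u f y (ladder_succ Y u y)) =
          (\<Sum>y\<in>ladder_face Y u. \<alpha> (u, y) * indicat_real (A (u, y)) x)"
        by (simp add: \<alpha>_def sum_distrib_left mult.assoc)
    qed
    also have "\<dots> = (\<Sum>k\<in>?K. \<alpha> k * indicat_real (A k) x)"
      by (subst sum.Sigma) (auto simp: finite_ladder_face[OF Y] intro: sum.cong)
    finally show ?thesis .
  qed
  show "g \<in> simple_space Rstar" by (rule simple_finite_sum(1)[OF K A g])
  have "V_simple Rstar g \<le> ennreal (\<Sum>k\<in>?K. \<bar>\<alpha> k\<bar> * real (harman Rstar (A k)))"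
    by (rule simple_finite_sum(2)[OF K A g])
  also have "\<dots> \<le> ennreal (\<Sum>u\<in>{u. u \<noteq> {}}. ladder_variation Y u f)"
  proof (rule ennreal_leI)
    have "(\<Sum>k\<in>?K. \<bar>\<alpha> k\<bar> * real (harman Rstar (A k))) =
        (\<Sum>u\<in>UNIV. \<Sum>y\<in>ladder_face Y u. \<bar>\<alpha> (u, y)\<bar> * real (harman Rstar (A (u, y))))"
      by (subst sum.Sigma) (auto simp: finite_ladder_face[OF Y] intro: sum.cong)
    also have "\<dots> = (\<Sum>u\<in>{u. u \<noteq> {}}. \<Sum>y\<in>ladder_face Y u. \<bar>\<alpha> (u, y)\<bar> * real (harman Rstar (A (u, y))))"
    proof (intro sum.mono_neutral_right ballI)
      have "A ({}, y) = cbox 0 1" for y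
        by (auto simp: A_def mem_box_cart)
      then have "harman Rstar (A ({}, y)) = 0" for y by (simp add: harman_def)
      then show "(\<Sum>y\<in>ladder_face Y u. \<bar>\<alpha> (u, y)\<bar> * real (harman Rstar (A (u, y)))) = 0"
        if "u \<in> UNIV - {u. u \<noteq> {}}" for u using that by simp
    qed auto
    also have "\<dots> \<le> (\<Sum>u\<in>{u. u \<noteq> {}}. ladder_variation Y u f)"
      unfolding ladder_variation_def
    proof (intro sum_mono)
      fix u y
      have "\<bar>\<alpha> (u, y)\<bar> * real (harman Rstar (A (u, y))) \<le> \<bar>\<alpha> (u, y)\<bar> * 1"
        using harman_Rstar_le_1[OF A] by (intro mult_left_mono) auto
      then show "\<bar>\<alpha> (u, y)\<bar> * real (harman Rstar (A (u, y))) \<le> \<bar>Delta u f y (ladder_succ Y u y)\<bar>"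
        by (simp add: \<alpha>_def abs_mult)
    qed
    finally show "(\<Sum>k\<in>?K. \<bar>\<alpha> k\<bar> * real (harman Rstar (A k))) \<le>
      (\<Sum>u\<in>{u. u \<noteq> {}}. ladder_variation Y u f)" .
  qed
  also have "\<dots> \<le> HK f" by (rule sum_ladder_variation_le_HK[OF Y])
  finally show "V_simple Rstar g \<le> HK f" .
qed

text \<open>
  Passing from \<open>x\<close> to \<open>\<rho>(x)\<close> one coordinate at a time costs at most \<open>\<delta>\<close> per coordinate.
\<close>

lemma finite_HK_uniform_approximation:
  fixes f :: "real^'n::finite \<Rightarrow> real"
  assumes HK: "HK f < \<infinity>" and e: "0 < e"
  obtains g where "g \<in> simple_space Rstar" "V_simple Rstar g \<le> HK f"
    "\<And>x. x \<in> cbox 0 1 \<Longrightarrow> \<bar>f x - g x\<bar> < e"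
proof -
  obtain C where C: "0 \<le> C" "HK f = ennreal C"
    using HK by (cases "HK f") auto
  have tot: "(\<Sum>u\<in>{u. u \<noteq> {}}. ladder_variation Y u f) \<le> C" if "Y \<in> ladders" for Y
    using sum_ladder_variation_le_HK[OF that, of f] C by simp
  define \<delta> where "\<delta> = e / (2 * real CARD('n))"
  have \<delta>: "0 < \<delta>" "real CARD('n) * \<delta> < e" using e by (auto simp: \<delta>_def)
  obtain \<rho> where mono: "\<And>j. mono_on {0..1} (\<rho> j)" and range: "\<And>j. \<rho> j ` {0..1} \<subseteq> {0..1}"
    and fin: "\<And>j. finite (\<rho> j ` {0..1})"
    and close: "\<And>j. \<forall>p\<in>cbox 0 1. \<forall>q\<in>cbox 0 1. (\<forall>i. i \<noteq> j \<longrightarrow> p $ i = q $ i) \<longrightarrow>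
      q $ j = \<rho> j (p $ j) \<longrightarrow> \<bar>f p - f q\<bar> \<le> \<delta>"
  proof -
    have "\<forall>j. \<exists>\<rho>. mono_on {0..1} \<rho> \<and> \<rho> ` {0..1} \<subseteq> {0..1} \<and> finite (\<rho> ` {0..1}) \<and>
      (\<forall>p\<in>cbox 0 1. \<forall>q\<in>cbox 0 1. (\<forall>i. i \<noteq> j \<longrightarrow> p $ i = q $ i) \<longrightarrow> q $ j = \<rho> (p $ j) \<longrightarrow>
        \<bar>f p - f q\<bar> \<le> \<delta>)"
      using coordinate_quantizer[OF tot \<delta>(1)] by (rule allI)
    from choice[OF this] show ?thesis using that by blast
  qed
  define g where "g x = f (\<chi> i. \<rho> i (x $ i))" for x
  have "\<bar>f x - g x\<bar> < e" if x: "x \<in> cbox 0 1" for x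
  proof -
    let ?r = "(\<chi> i. \<rho> i (x $ i)) :: real^'n"
    have x01: "x $ i \<in> {0..1}" for i using x by (simp add: mem_box_cart)
    have r01: "\<rho> i (x $ i) \<in> {0..1}" for i using range[of i] x01 by blast
    have cube: "glue ?r S x \<in> cbox 0 1" for S
      using x01 r01 by (simp add: mem_box_cart)
    have "\<bar>f x - f (glue ?r S x)\<bar> \<le> real (card S) * \<delta>" if "finite S" for S
      using that
    proof induction
      case empty
      have "glue ?r {} x = x" by (simp add: vec_eq_iff)
      then show ?case by simp
    next
      case (insert j S)
      have "\<bar>f (glue ?r S x) - f (glue ?r (insert j S) x)\<bar> \<le> \<delta>"
        using insert.hyps by (intro close[of j, rule_format] cube) auto
      then show ?case using insert by (simp add: algebra_simps)
    qed
    from this[of UNIV] have "\<bar>f x - f (glue ?r UNIV x)\<bar> \<le> real CARD('n) * \<delta>" by simp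
    moreover have "glue ?r UNIV x = ?r" by (simp add: vec_eq_iff)
    ultimately show ?thesis using \<delta>(2) by (simp add: g_def)
  qed
  moreover have "g \<in> simple_space Rstar" "V_simple Rstar g \<le> HK f"
    using quantized_function_simple[OF mono range fin, of f] by (simp_all add: g_def[abs_def])
  ultimately show ?thesis using that by blast
qed

section \<open>Equality of the two variations\<close>

lemma simple_space_Rstar_measurable:
  assumes "g \<in> simple_space Rstar"
  shows "g \<in> borel_measurable (restrict_space borel (cbox 0 (1 :: real^'n::finite)))"
proof -
  obtain m \<alpha> A where rep: "simple_rep Rstar g m \<alpha> A"
    using assms by (auto simp: simple_space_def)
  have "(\<lambda>x. \<Sum>i=1..m. \<alpha> i * indicat_real (A i) x) \<in> borel_measurable borel"
    using rep Rstar_borel unfolding simple_rep_def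
    by (intro borel_measurable_sum borel_measurable_times borel_measurable_const borel_measurable_indicator) auto
  then have "(\<lambda>x. \<Sum>i=1..m. \<alpha> i * indicat_real (A i) x) \<in> borel_measurable (restrict_space borel (cbox 0 1))"
    by (rule measurable_restrict_space1)
  then show ?thesis
    using rep by (subst measurable_cong) (auto simp: simple_rep_def space_restrict_space)
qed

lemma V_var_le_HK:
  fixes f :: "real^'n::finite \<Rightarrow> real"
  shows "V_var Rstar f \<le> HK f"
proof (cases "HK f < \<infinity>")
  case True
  have "\<exists>g. g \<in> simple_space Rstar \<and> V_simple Rstar g \<le> HK f \<and>
      (\<forall>x\<in>cbox 0 1. \<bar>f x - g x\<bar> < 1 / real (Suc k))" for k
    by (rule finite_HK_uniform_approximation[OF True, of "1 / real (Suc k)"]) (simp, blast)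
  then obtain g where g: "\<And>k. g k \<in> simple_space Rstar" "\<And>k. V_simple Rstar (g k) \<le> HK f"
    and close: "\<And>k x. x \<in> cbox 0 1 \<Longrightarrow> \<bar>f x - g k x\<bar> < 1 / real (Suc k)"
    by metis
  have unif: "uniform_limit (cbox 0 1) g f sequentially"
  proof (rule uniform_limitI)
    fix e :: real assume "0 < e"
    then obtain N where N: "1 / real (Suc N) < e" by (meson nat_approx_posE)
    have "dist (g k x) (f x) < e" if "N \<le> k" "x \<in> cbox 0 1" for k x
    proof -
      have "1 / real (Suc k) \<le> 1 / real (Suc N)" using that by (intro divide_left_mono) auto
      then show ?thesis
        using close[OF that(2), of k] N by (simp add: dist_real_def abs_minus_commute)
    qed
    then show "\<forall>\<^sub>F k in sequentially. \<forall>x\<in>cbox 0 1. dist (g k x) (f x) < e"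
      by (auto simp: eventually_sequentially)
  qed
  then have mem: "g \<in> approx_seqs Rstar f" using g by (simp add: approx_seqs_def)
  have "f \<in> borel_measurable (restrict_space borel (cbox 0 1))"
    by (rule borel_measurable_LIMSEQ_real[of _ g])
       (use unif in \<open>auto intro: simple_space_Rstar_measurable g tendsto_uniform_limitI
         simp: space_restrict_space\<close>)
  then have "f \<in> V_infty Rstar" using mem by (auto simp: V_infty_def)
  then have "V_var Rstar f \<le> liminf (\<lambda>k. V_simple Rstar (g k))"
    using mem by (auto simp: V_var_def intro: INF_lower)
  also have "\<dots> \<le> liminf (\<lambda>k::nat. HK f)"
    by (intro Liminf_mono always_eventually allI g(2))
  finally show ?thesis by (simp add: Liminf_const)
next
  case False
  then show ?thesis by (simp add: less_top[symmetric])
qed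

theorem corollary4p3:
  "(HK_space :: (real^'n \<Rightarrow> real) set) = V_space Rstar \<and>
   (\<forall>f :: real^'n \<Rightarrow> real. HK f = V_var Rstar f)"
proof
  have eq: "HK f = V_var Rstar f" for f :: "real^'n \<Rightarrow> real"
    using HK_le_V_var V_var_le_HK by (rule antisym)
  then show "\<forall>f :: real^'n \<Rightarrow> real. HK f = V_var Rstar f" by simp
  have "f \<in> V_infty Rstar" if "V_var Rstar f < \<infinity>" for f :: "real^'n \<Rightarrow> real"
    using that by (auto simp: V_var_def split: if_splits)
  then show "(HK_space :: (real^'n \<Rightarrow> real) set) = V_space Rstar"
    by (auto simp: HK_space_def V_space_def eq)
qed

end
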